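(* For all integers $M,N\ge1$, the left absorbing probabilities of the Grover walk with absorbing boundaries at $-M$ and $N$ satisfy $$P_{\underline{-M,0,N}}(1,0,0)=\frac1{2\pi}\int_0^{2\pi}\Big|l(N,e^{i\theta})\prod_{k=1}^{M-1}l(N+k,e^{i\theta})\Big|^2d\theta,$$ $$P_{\underline{-M,0,N}}(0,1,0)=\frac1{2\pi}\int_0^{2\pi}\Big|s(N,e^{i\theta})\prod_{k=1}^{M-1}l(N+k,e^{i\theta})\Big|^2d\theta,$$ $$P_{\underline{-M,0,N}}(0,0,1)=\frac1{2\pi}\int_0^{2\pi}\Big|r(N,e^{i\theta})\prod_{k=1}^{M-1}l(N+k,e^{i\theta})\Big|^2d\theta,$$ where $l(n,z),s(n,z),r(n,z)$ are the generating functions of the walk with boundaries at $-1$ and $n$.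
   Context: The Grover walk acts on the Hilbert space $\mathcal H=\ell^2(\mathbb Z)\otimes\mathbb C^3$ with orthonormal basis $|m,c\rangle=|m\rangle\otimes|c\rangle$, $m\in\mathbb Z$, $c\in\{L,S,R\}$. The evolution operator is $U=\mathrm{Sh}\cdot(I\otimes G)$, where, in the ordered basis $(L,S,R)$, $G=\frac13\begin{pmatrix}-1&2&2\\2&-1&2\\2&2&-1\end{pmatrix}$, and the shift is $\mathrm{Sh}|m,L\rangle=|m-1,L\rangle$, $\mathrm{Sh}|m,S\rangle=|m,S\rangle$, $\mathrm{Sh}|m,R\rangle=|m+1,R\rangle$. For $n\in\mathbb Z$, $\Pi_{yes}^{n}=|n\rangle\langle n|\otimes I$ and $\Pi_{no}^{n}=I-\Pi_{yes}^{n}$. Two-boundary process with boundaries $-M<0<N$: start in $\psi_0=\alpha|0,L\rangle+\beta|0,S\rangle+\gamma|0,R\rangle$ (unit vector); at each step apply $U$, measure $\{\Pi_{yes}^{-M},\Pi_{no}^{-M}\}$, then measure $\{\Pi_{yes}^{N},\Pi_{no}^{N}\}$, stopping when either outcome is "yes". The left absorbing probability is $$P_{\underline{-M,0,N}}(\alpha,\beta,\gamma)=\sum_{t\ge1}\big\|\Pi_{yes}^{-M}U(\Pi_{no}^{N}\Pi_{no}^{-M}U)^{t-1}\psi_0\big\|^2 .$$ For $n\ge1$ and $c=L,S,R$ respectively, $l(n,z),s(n,z),r(n,z)=\sum_{t\ge1}\langle-1,L|U(\Pi_{no}^{n}\Pi_{no}^{-1}U)^{t-1}|0,c\rangle z^t$.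 These are rational functions of $z$; their values at $z=e^{i\theta}$ are the (boundary) values on the unit circle, with removable singularities removed. An empty product equals $1$. *)

theory Defs
  imports "HOL-Analysis.Analysis"
begin

datatype coin = CL | CS | CR

lemma UNIV_coin: "(UNIV :: coin set) = {CL, CS, CR}"
  using coin.exhaust by auto

instance coin :: finite
  by standard (simp add: UNIV_coin)

text \<open>
  A vector of \<open>l^2(Z) \<otimes> C^3\<close> is given by its coefficients in the orthonormal basis
  \<open>|m,c>\<close>, so it is a function on \<open>Z \<times> {L,S,R}\<close> belonging to \<open>ell2\<close>.  The operators are
  defined on all coefficient functions; the closure lemmas below show that they restrict
  to \<open>ell2\<close>.
\<close>

type_synonym state = "int \<times> coin \<Rightarrow> complex"

definition ell2 :: "state set" where
  "ell2 = {\<psi>. (\<lambda>x. (cmod (\<psi> x))\<^sup>2) summable_on UNIV}"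

definition ell2_norm :: "state \<Rightarrow> real" where
  "ell2_norm \<psi> = sqrt (\<Sum>\<^sub>\<infinity>x. (cmod (\<psi> x))\<^sup>2)"

definition braket :: "state \<Rightarrow> state \<Rightarrow> complex" where
  "braket \<phi> \<psi> = (\<Sum>\<^sub>\<infinity>x. cnj (\<phi> x) * \<psi> x)"

definition ket :: "int \<Rightarrow> coin \<Rightarrow> state" where
  "ket m c = (\<lambda>x. if x = (m, c) then 1 else 0)"

definition grover :: "complex ^ coin ^ coin" where
  "grover = (\<chi> c d. (if c = d then -1 else 2) / 3)"

definition coin_op :: "state \<Rightarrow> state" where
  "coin_op \<psi> = (\<lambda>(m, c). (grover *v (\<chi> d. \<psi> (m, d))) $ c)"

text \<open>
  On coefficients the shift acts by pulling back along the inverse displacement; see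
  \<open>shift_op_ket\<close> for the action on basis vectors.
\<close>

fun displacement :: "coin \<Rightarrow> int" where
  "displacement CL = -1"
| "displacement CS = 0"
| "displacement CR = 1"

definition shift_op :: "state \<Rightarrow> state" where
  "shift_op \<psi> = (\<lambda>(m, c). \<psi> (m - displacement c, c))"

definition evolution :: "state \<Rightarrow> state" where
  "evolution \<psi> = shift_op (coin_op \<psi>)"

definition Pi_yes :: "int \<Rightarrow> state \<Rightarrow> state" where
  "Pi_yes n \<psi> = (\<lambda>(m, c). if m = n then \<psi> (m, c) else 0)"

definition Pi_no :: "int \<Rightarrow> state \<Rightarrow> state" where
  "Pi_no n \<psi> = (\<lambda>x. \<psi> x - Pi_yes n \<psi> x)"

definition survive :: "int \<Rightarrow> int \<Rightarrow> state \<Rightarrow> state" where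
  "survive a b \<psi> = Pi_no b (Pi_no a (evolution \<psi>))"

definition init_state :: "complex \<Rightarrow> complex \<Rightarrow> complex \<Rightarrow> state" where
  "init_state \<alpha> \<beta> \<gamma> = (\<lambda>x. \<alpha> * ket 0 CL x + \<beta> * ket 0 CS x + \<gamma> * ket 0 CR x)"

text \<open>In both series below the index \<open>t\<close> counts from 0, so absorption happens at time \<open>t + 1\<close>.\<close>

definition left_absorb_prob :: "int \<Rightarrow> int \<Rightarrow> complex \<Rightarrow> complex \<Rightarrow> complex \<Rightarrow> real" where
  "left_absorb_prob M N \<alpha> \<beta> \<gamma> =
     (\<Sum>t. (ell2_norm (Pi_yes (-M) (evolution
              ((survive (-M) N ^^ t) (init_state \<alpha> \<beta> \<gamma>)))))\<^sup>2)"

definition gen_series :: "coin \<Rightarrow> int \<Rightarrow> complex \<Rightarrow> complex" where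
  "gen_series c n w =
     (\<Sum>t. braket (ket (-1) CL) (evolution ((survive (-1) n ^^ t) (ket 0 c))) * w ^ Suc t)"

text \<open>
  The power series converges in the open unit disc to a rational function; its value at a
  point of the unit circle is the boundary value of that function, i.e. the limit from inside
  the disc.  (In particular removable singularities of a representing quotient are removed.)
\<close>

definition gen_fun :: "coin \<Rightarrow> int \<Rightarrow> complex \<Rightarrow> complex" where
  "gen_fun c n z = Lim (at z within ball 0 1) (gen_series c n)"

abbreviation gen_l :: "int \<Rightarrow> complex \<Rightarrow> complex" where "gen_l \<equiv> gen_fun CL"
abbreviation gen_s :: "int \<Rightarrow> complex \<Rightarrow> complex" where "gen_s \<equiv> gen_fun CS"
abbreviation gen_r :: "int \<Rightarrow> complex \<Rightarrow> complex" where "gen_r \<equiv> gen_fun CR"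

lemma shift_op_ket:
  "shift_op (ket m CL) = ket (m - 1) CL"
  "shift_op (ket m CS) = ket m CS"
  "shift_op (ket m CR) = ket (m + 1) CR"
  by (auto simp: shift_op_def ket_def fun_eq_iff)

lemma braket_ket: "braket (ket m c) \<psi> = \<psi> (m, c)"
proof -
  have "braket (ket m c) \<psi> = (\<Sum>\<^sub>\<infinity>x\<in>{(m, c)}. cnj (ket m c x) * \<psi> x)"
    unfolding braket_def by (rule infsum_cong_neutral) (auto simp: ket_def)
  then show ?thesis by (simp add: ket_def)
qed

lemma ket_ell2: "ket m c \<in> ell2"
proof -
  have "(\<lambda>x. (cmod (ket m c x))\<^sup>2) summable_on {(m, c)}" by simp
  then show ?thesis unfolding ell2_def mem_Collect_eq
    by (rule summable_on_cong_neutral[THEN iffD1, rotated -1]) (auto simp: ket_def)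
qed

lemma ell2_dominated:
  assumes "\<phi> \<in> ell2" "\<And>x. cmod (\<psi> x) \<le> cmod (\<phi> x)"
  shows "\<psi> \<in> ell2"
  using assms unfolding ell2_def mem_Collect_eq
  by (auto intro!: summable_on_comparison_test[where f = "\<lambda>x. (cmod (\<phi> x))\<^sup>2"] power_mono)

lemma ell2_scale: "\<psi> \<in> ell2 \<Longrightarrow> (\<lambda>x. a * \<psi> x) \<in> ell2"
  unfolding ell2_def mem_Collect_eq norm_mult power_mult_distrib
  by (rule summable_on_cmult_right[where c = "(cmod a)\<^sup>2"])

lemma ell2_add:
  assumes "\<phi> \<in> ell2" "\<psi> \<in> ell2"
  shows "(\<lambda>x. \<phi> x + \<psi> x) \<in> ell2"
proof -
  have "(cmod (\<phi> x + \<psi> x))\<^sup>2 \<le> 2 * ((cmod (\<phi> x))\<^sup>2 + (cmod (\<psi> x))\<^sup>2)" for x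
  proof -
    have "(cmod (\<phi> x + \<psi> x))\<^sup>2 \<le> (cmod (\<phi> x) + cmod (\<psi> x))\<^sup>2"
      by (intro power_mono norm_triangle_ineq) auto
    also have "\<dots> \<le> 2 * ((cmod (\<phi> x))\<^sup>2 + (cmod (\<psi> x))\<^sup>2)"
      using sum_squares_bound[of "cmod (\<phi> x)" "cmod (\<psi> x)"] by (simp add: power2_sum)
    finally show ?thesis .
  qed
  note le = this
  have sm: "(\<lambda>x. 2 * ((cmod (\<phi> x))\<^sup>2 + (cmod (\<psi> x))\<^sup>2)) summable_on UNIV"
    using assms unfolding ell2_def mem_Collect_eq
    by (intro summable_on_cmult_right[where c = "2 :: real"] summable_on_add)
  have "(\<lambda>x. (cmod (\<phi> x + \<psi> x))\<^sup>2) summable_on UNIV"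
    by (rule summable_on_comparison_test[OF sm]) (rule le, rule zero_le_power2)
  then show ?thesis by (simp add: ell2_def)
qed

lemma ell2_reindex: "\<psi> \<in> ell2 \<Longrightarrow> bij f \<Longrightarrow> (\<lambda>x. \<psi> (f x)) \<in> ell2"
  unfolding ell2_def using summable_on_reindex_bij_betw[of f UNIV UNIV "\<lambda>x. (cmod (\<psi> x))\<^sup>2"]
  by simp

lemma shift_op_ell2: "\<psi> \<in> ell2 \<Longrightarrow> shift_op \<psi> \<in> ell2"
proof -
  assume "\<psi> \<in> ell2"
  moreover have "bij (\<lambda>(m, c). (m - displacement c, c))"
    by (rule bij_betw_byWitness[where f' = "\<lambda>(m, c). (m + displacement c, c)"]) auto
  ultimately have "(\<lambda>x. \<psi> ((\<lambda>(m, c). (m - displacement c, c)) x)) \<in> ell2"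
    by (rule ell2_reindex)
  then show ?thesis by (simp add: shift_op_def case_prod_unfold)
qed

fun next_coin :: "coin \<Rightarrow> coin" where
  "next_coin CL = CS" | "next_coin CS = CR" | "next_coin CR = CL"

lemma coin_op_apply:
  "coin_op \<psi> (m, c) = (-1/3) * \<psi> (m, c) + ((2/3) * \<psi> (m, next_coin c)
     + (2/3) * \<psi> (m, next_coin (next_coin c)))"
  by (cases c) (simp_all add: coin_op_def grover_def matrix_vector_mult_def UNIV_coin)

lemma coin_op_ell2:
  assumes "\<psi> \<in> ell2"
  shows "coin_op \<psi> \<in> ell2"
proof -
  let ?f = "\<lambda>x :: int \<times> coin. (fst x, next_coin (snd x))"
  have cyc: "next_coin (next_coin (next_coin c)) = c" for c by (cases c) auto
  have "bij ?f"
    by (rule bij_betw_byWitness[where f' = "\<lambda>x. ?f (?f x)"]) (auto simp: cyc)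
  then have 1: "(\<lambda>x. \<psi> (?f x)) \<in> ell2" "(\<lambda>x. \<psi> (?f (?f x))) \<in> ell2"
    using ell2_reindex[OF assms, of ?f] ell2_reindex[of "\<lambda>x. \<psi> (?f x)" ?f] by simp_all
  have "coin_op \<psi> = (\<lambda>x. (-1/3) * \<psi> x + ((2/3) * \<psi> (?f x) + (2/3) * \<psi> (?f (?f x))))"
    by (auto simp: fun_eq_iff coin_op_apply)
  then show ?thesis
    using ell2_add[OF ell2_scale[OF assms] ell2_add[OF ell2_scale[OF 1(1)] ell2_scale[OF 1(2)]]]
    by (simp only:)
qed

lemma evolution_ell2: "\<psi> \<in> ell2 \<Longrightarrow> evolution \<psi> \<in> ell2"
  by (simp add: evolution_def shift_op_ell2 coin_op_ell2)

lemma Pi_yes_ell2: "\<psi> \<in> ell2 \<Longrightarrow> Pi_yes n \<psi> \<in> ell2"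
  by (erule ell2_dominated) (auto simp: Pi_yes_def)

lemma Pi_no_ell2: "\<psi> \<in> ell2 \<Longrightarrow> Pi_no n \<psi> \<in> ell2"
  by (erule ell2_dominated) (auto simp: Pi_no_def Pi_yes_def)

lemma survive_ell2: "\<psi> \<in> ell2 \<Longrightarrow> (survive a b ^^ t) \<psi> \<in> ell2"
  by (induction t) (auto simp: survive_def intro: evolution_ell2 Pi_no_ell2)

lemma init_state_ell2: "init_state \<alpha> \<beta> \<gamma> \<in> ell2"
  unfolding init_state_def by (intro ell2_add ell2_scale ket_ell2)

end

theory Submission
  imports Defs "HOL-Complex_Analysis.Laurent_Convergence"
begin

text \<open>
  To be absorbed at \<open>-M\<close> the walk must pass \<open>-1, -2, \<dots>, -M\<close> in turn, arriving at each for the first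
  time in coin state \<open>L\<close>.  Splitting at the first visit to \<open>-1\<close> and translating, the generating
  function of the absorption amplitudes at \<open>-M\<close> is the product of those for boundaries \<open>-1\<close> and
  \<open>N + k\<close>, \<open>0 \<le> k < M\<close>, and the absorption probability is its squared norm by Parseval.

  Boundary values cause no trouble: between two boundaries the walk is finite-dimensional, so
  each generating function is rational, and by unitarity its coefficients are square summable.
  Square summability bounds the function by \<open>O((1 - |z|)^(-1/2))\<close>, which excludes poles on the unit
  circle although the walk itself has eigenvalues there (localised states).  Hence the radius of
  convergence exceeds 1.
\<close>

section \<open>Square-summable rational power series and Parseval's identity\<close>

text \<open>Gaussian elimination: a pivot \<open>v k y\<close> removes the equation at
  \<open>y\<close> together with the unknown \<open>k\<close>. It later supplies a linear relation
  among iterates of the walk.\<close>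

lemma homogeneous_system_nontrivial_solution:
  fixes v :: "'j \<Rightarrow> 'x \<Rightarrow> 'a::field"
  assumes "finite X" "finite J" "card X < card J"
  shows "\<exists>c. (\<exists>j\<in>J. c j \<noteq> 0) \<and> (\<forall>x\<in>X. (\<Sum>j\<in>J. c j * v j x) = 0)"
  using assms
proof (induction X arbitrary: J v rule: finite_induct)
  case empty
  then have "J \<noteq> {}" by auto
  then show ?case by (intro exI[of _ "\<lambda>_. 1"]) auto
next
  case (insert y X)
  show ?case
  proof (cases "\<exists>k\<in>J. v k y \<noteq> 0")
    case False
    from insert have "card X < card J" by simp
    from insert.IH[OF insert.prems(1) this, of v] obtain c where
      "\<exists>j\<in>J. c j \<noteq> 0" "\<forall>x\<in>X. (\<Sum>j\<in>J. c j * v j x) = 0" by blast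
    with False show ?thesis by (intro exI[of _ c]) (auto intro!: sum.neutral)
  next
    case True
    then obtain k where k: "k \<in> J" "v k y \<noteq> 0" by blast
    define w where "w j x = v j x - v j y / v k y * v k x" for j x
    from insert k have "finite (J - {k})" "card X < card (J - {k})" by simp_all
    from insert.IH[OF this, of w] obtain c where
      c: "\<exists>j\<in>J - {k}. c j \<noteq> 0" "\<forall>x\<in>X. (\<Sum>j\<in>J - {k}. c j * w j x) = 0" by blast
    \<comment> \<open>Back substitution: the coefficient of the pivot vector is chosen so that the
      combination of the \<open>v j\<close> equals that of the reduced vectors
      \<open>w j\<close>.\<close>
    define c' where "c' = c(k := - (\<Sum>j\<in>J - {k}. c j * v j y / v k y))"
    have eq: "(\<Sum>j\<in>J. c' j * v j x) = (\<Sum>j\<in>J - {k}. c j * w j x)" for x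
    proof -
      have "(\<Sum>j\<in>J. c' j * v j x) = c' k * v k x + (\<Sum>j\<in>J - {k}. c' j * v j x)"
        using k insert.prems by (simp add: sum.remove)
      also have "(\<Sum>j\<in>J - {k}. c' j * v j x) = (\<Sum>j\<in>J - {k}. c j * v j x)"
        by (intro sum.cong) (auto simp: c'_def)
      also have "c' k * v k x + \<dots> = (\<Sum>j\<in>J - {k}. c j * w j x)"
        by (simp add: c'_def w_def algebra_simps sum_subtractf sum_distrib_left sum_negf)
      finally show ?thesis .
    qed
    have "w j y = 0" for j using k by (simp add: w_def)
    then have "\<forall>x\<in>insert y X. (\<Sum>j\<in>J. c' j * v j x) = 0" using c(2) unfolding eq by simp
    moreover have "\<exists>j\<in>J. c' j \<noteq> 0" using c(1) by (auto simp: c'_def)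
    ultimately show ?thesis by blast
  qed
qed

section \<open>Poles of square-summable rational series\<close>

text \<open>By AM-GM each term is at most the sum of the squared coefficient and
  \<open>(r ^ n)^2\<close>, both summable for r < 1.\<close>

lemma fps_conv_radius_ge_1_if_square_summable:
  fixes F :: "complex fps"
  assumes "summable (\<lambda>n. (cmod (fps_nth F n))\<^sup>2)"
  shows "fps_conv_radius F \<ge> 1"
  unfolding fps_conv_radius_def
proof (rule conv_radius_geI_ex')
  fix r :: real assume r: "0 < r" "ereal r < 1"
  then have "summable (\<lambda>n. (r\<^sup>2) ^ n)" by (intro summable_geometric) (auto simp: power_less_one_iff)
  with assms have s: "summable (\<lambda>n. (cmod (fps_nth F n))\<^sup>2 + (r\<^sup>2) ^ n)" by (rule summable_add)
  show "summable (\<lambda>n. fps_nth F n * of_real r ^ n)"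
  proof (rule summable_comparison_test'[OF s])
    fix n
    have "cmod (fps_nth F n) * r ^ n * 2 \<le> (cmod (fps_nth F n))\<^sup>2 + (r ^ n)\<^sup>2"
      using sum_squares_bound[of "cmod (fps_nth F n)" "r ^ n"] by simp
    moreover have "0 \<le> cmod (fps_nth F n) * r ^ n" using r by simp
    ultimately have "cmod (fps_nth F n) * r ^ n \<le> (cmod (fps_nth F n))\<^sup>2 + (r ^ n)\<^sup>2" by linarith
    then show "norm (fps_nth F n * of_real r ^ n) \<le> (cmod (fps_nth F n))\<^sup>2 + (r\<^sup>2) ^ n"
      using r by (simp add: norm_mult norm_power power_mult[symmetric] mult.commute)
  qed
qed

text \<open>The growth bound O((1 - |z|)^(-1/2)), multiplied by 1 - |z| so that it can be compared
  with a linear factor of a denominator.\<close>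

lemma eval_fps_square_summable_bound:
  fixes F :: "complex fps"
  assumes F: "summable (\<lambda>n. (cmod (fps_nth F n))\<^sup>2)" and z: "cmod z < 1"
  shows "(1 - cmod z) * cmod (eval_fps F z)
           \<le> sqrt (1 - cmod z) * ((\<Sum>n. (cmod (fps_nth F n))\<^sup>2) + 1)"
proof -
  define r where "r = cmod z"
  \<comment> \<open>This weight balances the two terms of the bound
    \<open>S / e + e / (1 - r)\<close>: both have order (1 - r)^(-1/2).\<close>
  define e where "e = sqrt (1 - r)"
  have r: "0 \<le> r" "r < 1" using z by (auto simp: r_def)
  then have e: "e > 0" "e\<^sup>2 = 1 - r" by (auto simp: e_def)
  define S where "S = (\<Sum>n. (cmod (fps_nth F n))\<^sup>2)"
  have "ereal (cmod z) < fps_conv_radius F"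
    using fps_conv_radius_ge_1_if_square_summable[OF F] z
    by (metis ereal_less(3) less_le_trans one_ereal_def)
  note sm = norm_summable_fps[OF this]
  have r2: "r\<^sup>2 < 1" using r by (simp add: power_less_one_iff)
  have geo: "(\<lambda>n. (r\<^sup>2) ^ n) sums (1 / (1 - r\<^sup>2))"
    using r2 by (intro geometric_sums) auto
  have bsums: "(\<lambda>n. (cmod (fps_nth F n))\<^sup>2 / e + e * (r\<^sup>2) ^ n) sums (S / e + e * (1 / (1 - r\<^sup>2)))"
    unfolding S_def by (intro sums_add sums_divide sums_mult geo summable_sums F)
  \<comment> \<open>AM-GM with weight \<open>e\<close>\<close>
  have le: "norm (fps_nth F n * z ^ n) \<le> (cmod (fps_nth F n))\<^sup>2 / e + e * (r\<^sup>2) ^ n" for n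
  proof -
    let ?a = "cmod (fps_nth F n)" let ?b = "r ^ n"
    have "2 * (?a * (e * ?b)) \<le> ?a\<^sup>2 + (e * ?b)\<^sup>2" using sum_squares_bound[of ?a "e * ?b"] by simp
    moreover have "0 \<le> ?a * (e * ?b)" using e r by simp
    ultimately have "?a * (e * ?b) \<le> ?a\<^sup>2 + (e * ?b)\<^sup>2" by linarith
    then have "?a * (e * ?b) / e \<le> (?a\<^sup>2 + (e * ?b)\<^sup>2) / e" using e by (intro divide_right_mono) auto
    then show ?thesis using e(1)
      by (simp add: norm_mult norm_power r_def add_divide_distrib power_mult_distrib
            power_mult[symmetric] mult.commute power2_eq_square[of e])
  qed
  have "cmod (eval_fps F z) \<le> (\<Sum>n. norm (fps_nth F n * z ^ n))"
    unfolding eval_fps_def by (rule summable_norm[OF sm])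
  also have "\<dots> \<le> S / e + e * (1 / (1 - r\<^sup>2))"
    using suminf_le[OF le sm sums_summable[OF bsums]] sums_unique[OF bsums] by simp
  also have "1 / (1 - r\<^sup>2) \<le> 1 / (1 - r)"
    using r r2 by (intro divide_left_mono) (auto simp: power2_eq_square mult_left_le_one_le)
  finally have "cmod (eval_fps F z) \<le> S / e + e * (1 / (1 - r))" using e by simp
  then have "(1 - r) * cmod (eval_fps F z) \<le> (1 - r) * (S / e + e * (1 / (1 - r)))"
    using r by (intro mult_left_mono) auto
  also have "\<dots> = e * (S + 1)"
    using e r by (simp add: e(2)[symmetric] field_simps power2_eq_square)
  finally show ?thesis by (simp add: r_def e_def S_def)
qed

text \<open>On the circle, approach the root along its radius: its linear factor in \<open>q\<close>
  contributes 1 - r, the series grows at most like (1 - r)^(-1/2), so \<open>p\<close> is O(sqrt(1 -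
  r)) there and vanishes in the limit.\<close>

lemma square_summable_rational_numerator_root:
  fixes F :: "complex fps"
  assumes F: "summable (\<lambda>n. (cmod (fps_nth F n))\<^sup>2)"
    and eq: "fps_of_poly q * F = fps_of_poly p" and z: "cmod \<zeta> \<le> 1" and root: "poly q \<zeta> = 0"
  shows "poly p \<zeta> = 0"
proof -
  have conv: "ereal (cmod w) < fps_conv_radius F" if "cmod w < 1" for w
    using fps_conv_radius_ge_1_if_square_summable[OF F] that
    by (metis ereal_less(3) less_le_trans one_ereal_def)
  have ev: "poly q w * eval_fps F w = poly p w" if "cmod w < 1" for w
    using eval_fps_mult[of w "fps_of_poly q" F] conv[OF that] eq by simp
  show ?thesis
  proof (cases "cmod \<zeta> < 1")
    case True
    with ev[OF True] root show ?thesis by simp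
  next
    case False
    with z have z1: "cmod \<zeta> = 1" by simp
    from root obtain q' where q': "q = [:-\<zeta>, 1:] * q'" by (auto simp: poly_eq_0_iff_dvd elim: dvdE)
    define C where "C = (\<Sum>n. (cmod (fps_nth F n))\<^sup>2) + 1"
    have bound: "cmod (poly p (of_real r * \<zeta>)) \<le> sqrt (1 - r) * C * cmod (poly q' (of_real r * \<zeta>))"
      if r: "0 < r" "r < 1" for r
    proof -
      let ?w = "of_real r * \<zeta>"
      have w: "cmod ?w = r" using r z1 by (simp add: norm_mult)
      have d: "cmod (?w - \<zeta>) = 1 - r"
      proof -
        have "?w - \<zeta> = of_real (r - 1) * \<zeta>" by (simp add: algebra_simps)
        then show ?thesis using r z1 by (simp add: norm_mult del: of_real_diff)
      qed
      have "cmod (poly p ?w) = cmod (poly q' ?w) * ((1 - r) * cmod (eval_fps F ?w))"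
      proof -
        have "poly q ?w = (?w - \<zeta>) * poly q' ?w" by (simp add: q' algebra_simps)
        then have "poly p ?w = (?w - \<zeta>) * poly q' ?w * eval_fps F ?w" using ev[of ?w] w r by simp
        then show ?thesis using d by (simp only: norm_mult mult_ac)
      qed
      also have "\<dots> \<le> cmod (poly q' ?w) * (sqrt (1 - r) * C)"
        using eval_fps_square_summable_bound[OF F, of ?w] w r
        by (intro mult_left_mono) (auto simp: C_def)
      finally show ?thesis by (simp add: mult_ac)
    qed
    have "((\<lambda>r. sqrt (1 - r) * C * cmod (poly q' (of_real r * \<zeta>))) \<longlongrightarrow>
            sqrt (1 - 1) * C * cmod (poly q' (of_real 1 * \<zeta>))) (at_left 1)"
      by (intro tendsto_intros)
    then have l0: "((\<lambda>r. sqrt (1 - r) * C * cmod (poly q' (of_real r * \<zeta>))) \<longlongrightarrow> 0) (at_left 1)" by simp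
    have evl: "eventually (\<lambda>r::real. norm (poly p (of_real r * \<zeta>)) \<le> sqrt (1 - r) * C * cmod (poly q' (of_real r * \<zeta>))) (at_left 1)"
      using eventually_at_left_real[of 0 1] by (auto elim!: eventually_mono intro: bound)
    have "((\<lambda>r. poly p (of_real r * \<zeta>)) \<longlongrightarrow> 0) (at_left 1)"
      by (rule Lim_null_comparison[OF evl l0])
    moreover have "((\<lambda>r. poly p (of_real r * \<zeta>)) \<longlongrightarrow> poly p (of_real 1 * \<zeta>)) (at_left 1)"
      by (intro tendsto_intros)
    ultimately show ?thesis using tendsto_unique[of "at_left (1::real)"] by force
  qed
qed

text \<open>In a representation with denominator of least degree, every root of the denominator in the
  closed disc would be shared with the numerator and could be cancelled.\<close>

lemma square_summable_rational_conv_radius: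
  fixes F :: "complex fps"
  assumes F: "summable (\<lambda>n. (cmod (fps_nth F n))\<^sup>2)"
    and "q0 \<noteq> 0" "fps_of_poly q0 * F = fps_of_poly p0"
  shows "fps_conv_radius F > 1"
proof -
  define P where "P q \<longleftrightarrow> q \<noteq> 0 \<and> (\<exists>p. fps_of_poly q * F = fps_of_poly p)" for q
  have "P q0" using assms by (auto simp: P_def)
  then obtain q where q: "P q" and min: "\<And>q'. P q' \<Longrightarrow> degree q \<le> degree q'"
    using ex_has_least_nat[of P q0 degree] by blast
  from q obtain p where p: "q \<noteq> 0" "fps_of_poly q * F = fps_of_poly p" by (auto simp: P_def)
  have nz: "poly q \<zeta> \<noteq> 0" if z: "cmod \<zeta> \<le> 1" for \<zeta>
  proof
    assume root: "poly q \<zeta> = 0"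
    then have "poly p \<zeta> = 0" using square_summable_rational_numerator_root[OF F p(2) z] by simp
    with root obtain q' p' where q': "q = [:-\<zeta>, 1:] * q'" and p': "p = [:-\<zeta>, 1:] * p'"
      by (auto simp: poly_eq_0_iff_dvd elim!: dvdE)
    have "fps_of_poly [:-\<zeta>, 1:] * (fps_of_poly q' * F) = fps_of_poly [:-\<zeta>, 1:] * fps_of_poly p'"
      using p(2) unfolding q' p' fps_of_poly_mult by (simp only: mult.assoc)
    moreover have "fps_of_poly [:-\<zeta>, 1:] \<noteq> 0"
      using fps_of_poly_eq_iff[of "[:-\<zeta>, 1:]" 0] by simp
    ultimately have "fps_of_poly q' * F = fps_of_poly p'" by (metis mult_cancel_left)
    moreover have "q' \<noteq> 0" using p(1) q' by auto
    ultimately have "degree q \<le> degree q'" by (intro min) (auto simp: P_def)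
    moreover have "degree q = Suc (degree q')"
      using \<open>q' \<noteq> 0\<close> unfolding q' by (subst degree_mult_eq) auto
    ultimately show False by simp
  qed
  \<comment> \<open>The 2 keeps the set nonempty when \<open>q\<close> has no roots; any number
    above 1 would do.\<close>
  define R where "R = Min (insert 2 (cmod ` {z. poly q z = 0}))"
  have fin: "finite {z. poly q z = 0}" using p(1) by (rule poly_roots_finite)
  have R1: "R > 1" unfolding R_def
    using fin nz by (subst Min_gr_iff) (auto simp: not_le[symmetric])
  have R: "poly q z \<noteq> 0" if "cmod z < R" for z
  proof
    assume "poly q z = 0"
    then have "R \<le> cmod z" unfolding R_def using fin by (intro Min_le) auto
    with that show False by simp
  qed
  have conv: "fps_conv_radius F \<ge> 1" by (rule fps_conv_radius_ge_1_if_square_summable[OF F])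
  have "(\<lambda>z. poly p z / poly q z) has_fps_expansion F"
    unfolding has_fps_expansion_def
  proof
    show "0 < fps_conv_radius F" by (rule less_le_trans[OF _ conv]) simp
    have "eventually (\<lambda>z. z \<in> ball 0 1) (nhds (0::complex))"
      by (intro eventually_nhds_in_open) auto
    then show "\<forall>\<^sub>F z in nhds 0. eval_fps F z = poly p z / poly q z"
    proof eventually_elim
      case (elim z)
      then have "ereal (cmod z) < fps_conv_radius F" using conv
        by (metis ereal_less(3) less_le_trans mem_ball_0 one_ereal_def)
      then have "poly q z * eval_fps F z = poly p z"
        using eval_fps_mult[of z "fps_of_poly q" F] p(2) by simp
      then show ?case using nz[of z] elim by (auto simp: field_simps)
    qed
  qed
  moreover have "(\<lambda>z. poly p z / poly q z) holomorphic_on eball 0 (ereal R)"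
    using R by (auto intro!: holomorphic_intros)
  ultimately have "ereal R \<le> fps_conv_radius F" by (rule holomorphic_on_imp_fps_conv_radius_ge)
  moreover have "1 < ereal R" using R1 by (simp add: one_ereal_def)
  ultimately show ?thesis by (rule less_le_trans[rotated])
qed

section \<open>Parseval's identity on the unit circle\<close>

lemma has_integral_cis_of_int:
  "((\<lambda>\<theta>. cis (of_int k * \<theta>)) has_integral (if k = 0 then of_real (2 * pi) else 0)) {0..2 * pi}"
proof (cases "k = 0")
  case True
  then show ?thesis using has_integral_const_real[of "1::complex" 0 "2 * pi"]
    by (simp add: scaleR_conv_of_real)
next
  case False
  have "((\<lambda>\<theta>. cis (of_int k * \<theta>) / (\<i> * of_int k)) has_vector_derivative cis (of_int k * x))
          (at x within {0..2 * pi})" for x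
    using False unfolding cis_conv_exp
    by (auto intro!: derivative_eq_intros has_vector_derivative_real_field simp: field_simps)
  then have "((\<lambda>\<theta>. cis (of_int k * \<theta>)) has_integral
      (cis (of_int k * (2 * pi)) / (\<i> * of_int k) - cis (of_int k * 0) / (\<i> * of_int k))) {0..2 * pi}"
    by (intro fundamental_theorem_of_calculus) auto
  moreover have "cis (of_int k * (2 * pi)) = 1"
    using cis_multiple_2pi[of "of_int k"] by (simp add: mult_ac)
  ultimately show ?thesis using False by simp
qed

text \<open>Expanding the square gives a double sum of characters, of which orthogonality keeps the
  diagonal.\<close>

lemma has_integral_cmod_square_trig_polynomial:
  fixes h :: "nat \<Rightarrow> complex"
  shows "((\<lambda>\<theta>. (cmod (\<Sum>t<T. h t * cis \<theta> ^ t))\<^sup>2) has_integral 2 * pi * (\<Sum>t<T. (cmod (h t))\<^sup>2)) {0..2 * pi}"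
proof -
  let ?I = "\<lambda>k. if k = 0 then of_real (2 * pi) else (0 :: complex)"
  have "((\<lambda>\<theta>. \<Sum>s<T. \<Sum>t<T. h s * cnj (h t) * cis (of_int (int s - int t) * \<theta>)) has_integral
      (\<Sum>s<T. \<Sum>t<T. h s * cnj (h t) * ?I (int s - int t))) {0..2 * pi}"
    by (intro has_integral_sum has_integral_mult_right has_integral_cis_of_int) auto
  also have "(\<Sum>s<T. \<Sum>t<T. h s * cnj (h t) * ?I (int s - int t)) = (\<Sum>s<T. of_real (2 * pi * (cmod (h s))\<^sup>2))"
  proof (intro sum.cong refl)
    fix s assume "s \<in> {..<T}"
    then have "(\<Sum>t<T. h s * cnj (h t) * ?I (int s - int t)) =
        (\<Sum>t<T. if t = s then h s * cnj (h s) * of_real (2 * pi) else 0)"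
      by (intro sum.cong) auto
    also have "\<dots> = of_real (2 * pi * (cmod (h s))\<^sup>2)"
      using \<open>s \<in> {..<T}\<close> complex_norm_square[of "h s"] by (simp add: mult_ac)
    finally show "(\<Sum>t<T. h s * cnj (h t) * ?I (int s - int t)) = of_real (2 * pi * (cmod (h s))\<^sup>2)" .
  qed
  also have "\<dots> = of_real (2 * pi * (\<Sum>s<T. (cmod (h s))\<^sup>2))" by (simp add: sum_distrib_left)
  also have "(\<lambda>\<theta>. \<Sum>s<T. \<Sum>t<T. h s * cnj (h t) * cis (of_int (int s - int t) * \<theta>)) =
      (\<lambda>\<theta>. of_real ((cmod (\<Sum>t<T. h t * cis \<theta> ^ t))\<^sup>2))"
    unfolding complex_norm_square cnj_sum sum_product
    by (intro ext sum.cong refl)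
       (simp add: Complex.DeMoivre cis_cnj cis_mult algebra_simps complex_cnj_power flip: cis_divide)
  finally have "((\<lambda>\<theta>. complex_of_real ((cmod (\<Sum>t<T. h t * cis \<theta> ^ t))\<^sup>2)) has_integral
      of_real (2 * pi * (\<Sum>t<T. (cmod (h t))\<^sup>2))) {0..2 * pi}" .
  from has_integral_Re[OF this] show ?thesis by simp
qed

text \<open>A radius above 1 makes the coefficients absolutely summable, so the partial sums
  converge uniformly on the circle and the polynomial case passes to the limit under the
  integral.\<close>

lemma parseval_eval_fps:
  fixes F :: "complex fps"
  assumes "fps_conv_radius F > 1"
  shows "(\<lambda>t. (cmod (fps_nth F t))\<^sup>2) sums
           (1 / (2 * pi) * integral {0..2 * pi} (\<lambda>\<theta>. (cmod (eval_fps F (cis \<theta>)))\<^sup>2))"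
proof -
  let ?A = "{0..2 * pi}"
  have s1: "summable (\<lambda>n. norm (fps_nth F n))"
    using norm_summable_fps[of 1 F] assms by (simp add: one_ereal_def)
  have "uniform_limit ?A (\<lambda>n \<theta>. \<Sum>t<n. fps_nth F t * cis \<theta> ^ t)
          (\<lambda>\<theta>. \<Sum>t. fps_nth F t * cis \<theta> ^ t) sequentially"
    by (rule Weierstrass_m_test[OF _ s1]) (simp add: norm_mult norm_power)
  then have u: "uniform_limit ?A (\<lambda>n \<theta>. \<Sum>t<n. fps_nth F t * cis \<theta> ^ t)
          (\<lambda>\<theta>. eval_fps F (cis \<theta>)) sequentially"
    by (simp add: eval_fps_def)
  have c: "continuous_on ?A (\<lambda>\<theta>. \<Sum>t<n. fps_nth F t * cis \<theta> ^ t)" for n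
    by (intro continuous_intros)
  have un: "uniform_limit ?A (\<lambda>n \<theta>. cmod (\<Sum>t<n. fps_nth F t * cis \<theta> ^ t))
          (\<lambda>\<theta>. cmod (eval_fps F (cis \<theta>))) sequentially"
    using u by (rule uniform_limit_norm)
  have "continuous_on ?A (\<lambda>\<theta>. eval_fps F (cis \<theta>))"
    using u c by (intro uniform_limit_theorem[where f = "\<lambda>n \<theta>. \<Sum>t<n. fps_nth F t * cis \<theta> ^ t"]) auto
  \<comment> \<open>Boundedness of the limit is what lets uniform convergence survive
    squaring.\<close>
  then have "bounded ((\<lambda>\<theta>. cmod (eval_fps F (cis \<theta>))) ` ?A)"
    by (intro compact_imp_bounded compact_continuous_image continuous_on_norm) auto
  then have "uniform_limit ?A (\<lambda>n \<theta>. cmod (\<Sum>t<n. fps_nth F t * cis \<theta> ^ t) * cmod (\<Sum>t<n. fps_nth F t * cis \<theta> ^ t))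
          (\<lambda>\<theta>. cmod (eval_fps F (cis \<theta>)) * cmod (eval_fps F (cis \<theta>))) sequentially"
    by (intro uniform_lim_mult un)
  then have u2: "uniform_limit ?A (\<lambda>n \<theta>. (cmod (\<Sum>t<n. fps_nth F t * cis \<theta> ^ t))\<^sup>2)
          (\<lambda>\<theta>. (cmod (eval_fps F (cis \<theta>)))\<^sup>2) sequentially"
    by (simp only: power2_eq_square)
  obtain I J where I: "\<And>n. ((\<lambda>\<theta>. (cmod (\<Sum>t<n. fps_nth F t * cis \<theta> ^ t))\<^sup>2) has_integral I n) ?A"
    and J: "((\<lambda>\<theta>. (cmod (eval_fps F (cis \<theta>)))\<^sup>2) has_integral J) ?A" and lim: "I \<longlonglongrightarrow> J"
    by (rule uniform_limit_integral[OF u2]) (auto intro!: continuous_intros)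
  have "I = (\<lambda>n. 2 * pi * (\<Sum>t<n. (cmod (fps_nth F t))\<^sup>2))"
    by (rule ext, rule has_integral_unique[OF I has_integral_cmod_square_trig_polynomial])
  with lim have "(\<lambda>n. 2 * pi * (\<Sum>t<n. (cmod (fps_nth F t))\<^sup>2)) \<longlonglongrightarrow> J" by simp
  then have "(\<lambda>n. 1 / (2 * pi) * (2 * pi * (\<Sum>t<n. (cmod (fps_nth F t))\<^sup>2))) \<longlonglongrightarrow> 1 / (2 * pi) * J"
    by (intro tendsto_intros)
  then show ?thesis using integral_unique[OF J] by (simp add: sums_def)
qed

section \<open>Absorption amplitudes of the walk\<close>

definition confined :: "int \<Rightarrow> int \<Rightarrow> state \<Rightarrow> bool" where
  "confined a b \<psi> \<longleftrightarrow> (\<forall>m c. m \<notin> {a<..<b} \<longrightarrow> \<psi> (m, c) = 0)"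

text \<open>For a confined state this is the squared \<open>ell2\<close> norm, written as a finite
  sum.\<close>

definition mass :: "int \<Rightarrow> int \<Rightarrow> state \<Rightarrow> real" where
  "mass a b \<psi> = (\<Sum>m\<in>{a<..<b}. \<Sum>c\<in>UNIV. (cmod (\<psi> (m, c)))\<^sup>2)"

text \<open>The state moves \<open>k\<close> sites to the left: a ket at \<open>m\<close> becomes
  one at \<open>m - k\<close>.\<close>

definition translate :: "int \<Rightarrow> state \<Rightarrow> state" where
  "translate k \<psi> = (\<lambda>(m, c). \<psi> (m + k, c))"

text \<open>A state confined to the interior of \<open>[a, b]\<close> can only enter \<open>a\<close> with coin \<open>L\<close>, so the \<open>L\<close>
  component is the whole absorption amplitude.  With the factor \<open>fps_X\<close>, absorption at time \<open>t\<close>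
  (counted from 1) is the coefficient of \<open>X^t\<close>.\<close>

definition hit_fps :: "int \<Rightarrow> int \<Rightarrow> state \<Rightarrow> complex fps" where
  "hit_fps a b \<psi> =
     fps_X * Abs_fps (\<lambda>t. evolution ((survive a b ^^ t) \<psi>) (a, CL))"

lemma hit_fps_nth_0 [simp]: "fps_nth (hit_fps a b \<psi>) 0 = 0"
  by (simp add: hit_fps_def)

lemma hit_fps_nth_Suc [simp]:
  "fps_nth (hit_fps a b \<psi>) (Suc t) = evolution ((survive a b ^^ t) \<psi>) (a, CL)"
  by (simp add: hit_fps_def)

lemma evolution_apply: "evolution \<psi> (m, c) = coin_op \<psi> (m - displacement c, c)"
  by (simp add: evolution_def shift_op_def)

lemma survive_apply: "survive a b \<psi> (m, c) = (if m = a \<or> m = b then 0 else evolution \<psi> (m, c))"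
  by (auto simp: survive_def Pi_no_def Pi_yes_def)

lemma coin_op_confined: "confined a b \<psi> \<Longrightarrow> m \<notin> {a<..<b} \<Longrightarrow> coin_op \<psi> (m, c) = 0"
  unfolding coin_op_apply confined_def by simp

text \<open>A step moves by at most one site, so whatever leaves the interior lands on
  \<open>a\<close> or \<open>b\<close>, where \<open>survive\<close> clears it.\<close>

lemma confined_survive: "confined a b \<psi> \<Longrightarrow> confined a b (survive a b \<psi>)"
proof -
  assume \<psi>: "confined a b \<psi>"
  have "survive a b \<psi> (m, c) = 0" if "m \<notin> {a<..<b}" for m c
    using that \<psi> by (cases c) (auto simp: survive_apply evolution_apply intro!: coin_op_confined)
  then show ?thesis by (simp add: confined_def)
qed

lemma confined_survive_power: "confined a b \<psi> \<Longrightarrow> confined a b ((survive a b ^^ t) \<psi>)"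
  by (induction t) (auto intro: confined_survive)

lemma confined_ket: "m \<in> {a<..<b} \<Longrightarrow> confined a b (ket m c)"
  by (auto simp: confined_def ket_def)

section \<open>Linearity in the initial state\<close>

lemma coin_op_sum:
  "coin_op (\<lambda>x. \<Sum>j\<in>J. c j * v j x) y = (\<Sum>j\<in>J. c j * coin_op (v j) y)"
  by (cases y) (simp add: coin_op_apply sum.distrib sum_distrib_left sum_subtractf sum_negf algebra_simps)

lemma evolution_sum:
  "evolution (\<lambda>x. \<Sum>j\<in>J. c j * v j x) y = (\<Sum>j\<in>J. c j * evolution (v j) y)"
  by (cases y) (simp add: evolution_apply coin_op_sum)

lemma survive_sum:
  "survive a b (\<lambda>x. \<Sum>j\<in>J. c j * v j x) = (\<lambda>x. \<Sum>j\<in>J. c j * survive a b (v j) x)"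
  by (rule ext, clarify) (simp add: survive_apply evolution_sum)

lemma survive_power_sum:
  "(survive a b ^^ t) (\<lambda>x. \<Sum>j\<in>J. c j * v j x) = (\<lambda>x. \<Sum>j\<in>J. c j * (survive a b ^^ t) (v j) x)"
  by (induction t) (simp_all add: survive_sum)

lemma hit_fps_sum:
  "hit_fps a b (\<lambda>x. \<Sum>j\<in>J. c j * v j x) = (\<Sum>j\<in>J. fps_const (c j) * hit_fps a b (v j))"
proof (rule fps_ext)
  fix n show "fps_nth (hit_fps a b (\<lambda>x. \<Sum>j\<in>J. c j * v j x)) n =
      fps_nth (\<Sum>j\<in>J. fps_const (c j) * hit_fps a b (v j)) n"
    by (cases n) (simp_all add: fps_sum_nth survive_power_sum evolution_sum)
qed

lemma hit_fps_add_scale: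
  "hit_fps a b (\<lambda>x. \<phi> x + c * \<psi> x) = hit_fps a b \<phi> + fps_const c * hit_fps a b \<psi>"
  using hit_fps_sum[of a b "\<lambda>i. if i then 1 else c" "\<lambda>i. if i then \<phi> else \<psi>" "{True, False}"]
  by simp

section \<open>Loss of mass by absorption\<close>

text \<open>Unitarity of the coin at one site: the Grover matrix is real orthogonal.\<close>

lemma cmod_square_coin_op:
  "(\<Sum>c\<in>UNIV. (cmod (coin_op \<psi> (m, c)))\<^sup>2) = (\<Sum>c\<in>UNIV. (cmod (\<psi> (m, c)))\<^sup>2)"
  unfolding UNIV_coin by (simp add: coin_op_apply cmod_power2) (simp add: power2_eq_square field_simps)

lemma sum_shift_le:
  fixes g :: "int \<Rightarrow> real"
  assumes "finite A" "finite B" "\<And>m. g m \<ge> 0" "\<And>m. m \<notin> B \<Longrightarrow> g m = 0"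
  shows "(\<Sum>m\<in>A. g (m - d)) \<le> (\<Sum>m\<in>B. g m)"
proof -
  have "(\<Sum>m\<in>A. g (m - d)) = (\<Sum>m\<in>(\<lambda>m. m - d) ` A. g m)"
    by (subst sum.reindex) (auto simp: inj_on_def)
  also have "\<dots> \<le> (\<Sum>m\<in>(\<lambda>m. m - d) ` A \<union> B. g m)"
    using assms by (intro sum_mono2) auto
  also have "\<dots> = (\<Sum>m\<in>B. g m)"
    using assms by (intro sum.mono_neutral_right) auto
  finally show ?thesis .
qed

text \<open>The coin preserves mass and the shift moves each coin component rigidly. Equality can
  fail because mass absorbed at \<open>b\<close> is not counted on the left.\<close>

lemma mass_survive:
  assumes \<psi>: "confined a b \<psi>"
  shows "(cmod (evolution \<psi> (a, CL)))\<^sup>2 + mass a b (survive a b \<psi>) \<le> mass a b \<psi>"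
proof -
  let ?I = "{a<..<b}"
  let ?g = "\<lambda>c m. (cmod (coin_op \<psi> (m, c)))\<^sup>2"
  have le: "(\<Sum>m\<in>A. ?g c (m - d)) \<le> (\<Sum>m\<in>?I. ?g c m)" if "finite A" for A c d
    using that coin_op_confined[OF \<psi>] by (intro sum_shift_le) auto
  have "mass a b (survive a b \<psi>) = (\<Sum>m\<in>?I. \<Sum>c\<in>UNIV. ?g c (m - displacement c))"
    unfolding mass_def by (intro sum.cong refl) (auto simp: survive_apply evolution_apply)
  also have "\<dots> = (\<Sum>m\<in>?I. ?g CL (m - -1)) + (\<Sum>m\<in>?I. ?g CS (m - 0)) + (\<Sum>m\<in>?I. ?g CR (m - 1))"
    by (simp add: UNIV_coin sum.distrib)
  \<comment> \<open>The amplitude absorbed at \<open>a\<close> is the \<open>CL\<close> summand at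
    \<open>m = a\<close>, so it extends that sum by one site.\<close>
  finally have "(cmod (evolution \<psi> (a, CL)))\<^sup>2 + mass a b (survive a b \<psi>) =
      (\<Sum>m\<in>insert a ?I. ?g CL (m - -1)) + (\<Sum>m\<in>?I. ?g CS (m - 0)) + (\<Sum>m\<in>?I. ?g CR (m - 1))"
    by (simp add: evolution_apply)
  also have "\<dots> \<le> (\<Sum>m\<in>?I. ?g CL m) + (\<Sum>m\<in>?I. ?g CS m) + (\<Sum>m\<in>?I. ?g CR m)"
    by (intro add_mono le) auto
  also have "\<dots> = (\<Sum>m\<in>?I. \<Sum>c\<in>UNIV. ?g c m)" by (simp add: UNIV_coin sum.distrib)
  also have "\<dots> = mass a b \<psi>" unfolding mass_def cmod_square_coin_op ..
  finally show ?thesis .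
qed

text \<open>Telescoping \<open>mass_survive\<close>: the mass absorbed at \<open>a\<close> up to any
  time is at most the initial mass.\<close>

lemma hit_fps_square_summable:
  assumes \<psi>: "confined a b \<psi>"
  shows "summable (\<lambda>n. (cmod (fps_nth (hit_fps a b \<psi>) n))\<^sup>2)"
proof -
  let ?e = "\<lambda>t. (cmod (evolution ((survive a b ^^ t) \<psi>) (a, CL)))\<^sup>2"
  have "(\<Sum>t<T. ?e t) + mass a b ((survive a b ^^ T) \<psi>) \<le> mass a b \<psi>" for T
  proof (induction T)
    case (Suc T)
    with mass_survive[OF confined_survive_power[OF \<psi>, of T]] show ?case by simp
  qed simp
  moreover have "mass a b \<phi> \<ge> 0" for \<phi> unfolding mass_def by (intro sum_nonneg) auto
  ultimately have "(\<Sum>t<T. ?e t) \<le> mass a b \<psi>" for T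
    by (meson add_increasing2 dual_order.refl order_trans)
  then have "summable ?e" by (intro summableI_nonneg_bounded[where x = "mass a b \<psi>"]) auto
  then show ?thesis
    using summable_Suc_iff[of "\<lambda>n. (cmod (fps_nth (hit_fps a b \<psi>) n))\<^sup>2"] by simp
qed

section \<open>Rationality of the absorption series\<close>

lemma hit_fps_rational:
  assumes \<psi>: "confined a b \<psi>"
  obtains q p where "q \<noteq> 0" "fps_of_poly q * hit_fps a b \<psi> = fps_of_poly p"
proof -
  \<comment> \<open>The powers of \<open>survive\<close> applied to \<open>\<psi>\<close> live in a space of dimension \<open>d = card X\<close>; a linear
    relation among the first \<open>d + 1\<close> of them is a linear recurrence for the coefficients.\<close>
  define X where "X = {a<..<b} \<times> (UNIV :: coin set)"
  define d where "d = card X"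
  define v where "v j = (survive a b ^^ j) \<psi>" for j
  have "finite X" "card X < card {..d}" by (auto simp: X_def d_def)
  from homogeneous_system_nontrivial_solution[OF this(1) _ this(2), of v] obtain c where
    c: "\<exists>j\<le>d. c j \<noteq> 0" "\<forall>x\<in>X. (\<Sum>j\<le>d. c j * v j x) = 0" by auto
  have zero: "(\<lambda>x. \<Sum>j\<le>d. c j * v j x) = (\<lambda>x. 0)"
  proof (rule ext)
    fix x show "(\<Sum>j\<le>d. c j * v j x) = 0"
      using c(2) confined_survive_power[OF \<psi>]
      by (cases "x \<in> X"; cases x) (auto simp: X_def v_def confined_def intro!: sum.neutral)
  qed
  define F where "F = hit_fps a b \<psi>"
  \<comment> \<open>The recurrence starts at coefficient 1, since coefficient 0 comes from
    \<open>fps_X\<close> and not from the walk.\<close>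
  have rec: "(\<Sum>j\<le>d. c j * fps_nth F (Suc t + j)) = 0" for t
  proof -
    have "(\<Sum>j\<le>d. c j * fps_nth F (Suc t + j)) =
        (\<Sum>j\<le>d. c j * evolution ((survive a b ^^ t) (v j)) (a, CL))"
      by (simp add: F_def v_def funpow_add)
    also have "\<dots> = evolution ((survive a b ^^ t) (\<lambda>x. \<Sum>j\<le>d. c j * v j x)) (a, CL)"
      by (simp add: survive_power_sum evolution_sum)
    also have "\<dots> = 0"
      \<comment> \<open>The empty index set in the linearity lemmas shows that the zero state stays
        zero.\<close>
      unfolding zero
      using survive_power_sum[of t a b "\<lambda>_. 0" "\<lambda>_ _. 0" "{}"] evolution_sum[of "\<lambda>_. 0" "\<lambda>_ _. 0" "{}"] by simp
    finally show ?thesis .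
  qed
  \<comment> \<open>Coefficients are reversed so that the recurrence becomes a convolution; by
    \<open>rec\<close> the product of \<open>q\<close> and \<open>F\<close> then vanishes from index
    d + 1 on.\<close>
  define q where "q = (\<Sum>j\<le>d. monom (c j) (d - j))"
  have coeff_q: "coeff q i = (if i \<le> d then c (d - i) else 0)" for i
  proof -
    have "coeff q i = (\<Sum>j\<le>d. if j = d - i \<and> i \<le> d then c j else 0)"
      unfolding q_def coeff_sum by (intro sum.cong) auto
    then show ?thesis by auto
  qed
  from c(1) obtain j where "j \<le> d" "c j \<noteq> 0" by blast
  then have "coeff q (d - j) \<noteq> 0" by (simp add: coeff_q)
  then have "q \<noteq> 0" by auto
  have tail: "fps_nth (fps_of_poly q * F) n = 0" if "n \<ge> Suc d" for n
  proof -
    have "fps_nth (fps_of_poly q * F) n = (\<Sum>i\<in>{0..n}. coeff q i * fps_nth F (n - i))"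
      by (simp add: fps_mult_nth)
    also have "\<dots> = (\<Sum>i\<le>d. c (d - i) * fps_nth F (n - i))"
      using that by (intro sum.mono_neutral_cong_right) (auto simp: coeff_q)
    also have "\<dots> = (\<Sum>j\<le>d. c j * fps_nth F (Suc (n - Suc d) + j))"
      using that by (intro sum.reindex_bij_witness[of _ "\<lambda>j. d - j" "\<lambda>i. d - i"]) (auto intro!: arg_cong[where f = "fps_nth F"])
    also have "\<dots> = 0" by (rule rec)
    finally show ?thesis .
  qed
  have "fps_of_poly q * F = fps_of_poly (truncate_fps (Suc d) (fps_of_poly q * F))"
    using tail by (intro fps_ext) (simp add: coeff_truncate_fps not_less del: fps_of_poly_truncate)
  with \<open>q \<noteq> 0\<close> that show thesis unfolding F_def by blast
qed

lemma hit_fps_conv_radius: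
  assumes "confined a b \<psi>"
  shows "fps_conv_radius (hit_fps a b \<psi>) > 1"
  by (rule hit_fps_rational[OF assms])
     (rule square_summable_rational_conv_radius[OF hit_fps_square_summable[OF assms]])

section \<open>Translation and first passage\<close>

text \<open>The evolution commutes with translations, and \<open>survive\<close> does so when its
  boundaries move along.\<close>

lemma hit_fps_translate: "hit_fps a b (translate k \<psi>) = hit_fps (a + k) (b + k) \<psi>"
proof -
  have evolution: "evolution (translate k \<phi>) = translate k (evolution \<phi>)" for \<phi>
    by (auto simp: fun_eq_iff translate_def evolution_apply coin_op_apply algebra_simps)
  have "survive a b (translate k \<phi>) = translate k (survive (a + k) (b + k) \<phi>)" for \<phi>
    by (auto simp: fun_eq_iff survive_apply evolution) (auto simp: translate_def survive_apply)
  then have "(survive a b ^^ t) (translate k \<phi>) = translate k ((survive (a + k) (b + k) ^^ t) \<phi>)" for t \<phi>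
    by (induction t) auto
  then show ?thesis by (simp add: hit_fps_def evolution) (simp add: translate_def)
qed

text \<open>Moving the left barrier away from \<open>a\<close> only lets through what arrives at
  \<open>a\<close>. The \<open>CS\<close> and \<open>CR\<close> parts there would come from
  \<open>a\<close> and \<open>a - 1\<close>, where the state vanishes.\<close>

lemma survive_decompose_at_barrier:
  assumes \<psi>: "confined a b \<psi>" and "a' < a" "a < b"
  shows "survive a' b \<psi> = (\<lambda>x. survive a b \<psi> x + evolution \<psi> (a, CL) * ket a CL x)"
proof (rule ext, clarify)
  fix m c
  have out: "evolution \<psi> (m, c) = 0" if "m < a"
    using that \<psi> by (cases c) (auto simp: evolution_apply intro!: coin_op_confined)
  have "evolution \<psi> (a, c) = 0" if "c \<noteq> CL"
    using that \<psi> by (cases c) (auto simp: evolution_apply intro!: coin_op_confined)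
  then show "survive a' b \<psi> (m, c) = survive a b \<psi> (m, c) + evolution \<psi> (a, CL) * ket a CL (m, c)"
    using assms(2,3) out by (cases "c = CL") (auto simp: survive_apply ket_def)
qed

text \<open>To reach \<open>a'\<close> the walk must first cross \<open>a\<close>, which it does in state \<open>|a,L>\<close>.\<close>

lemma hit_fps_first_passage:
  assumes \<psi>: "confined a b \<psi>" and ab: "a' < a" "a < b"
  shows "hit_fps a' b \<psi> = hit_fps a b \<psi> * hit_fps a' b (ket a CL)"
proof -
  let ?A = "survive a b" and ?B = "survive a' b"
  let ?h = "\<lambda>t \<phi>. evolution ((?B ^^ t) \<phi>) (a', CL)"
  let ?e = "\<lambda>\<phi>. evolution \<phi> (a, CL)"
  have step: "?h (Suc t) \<phi> = ?h t (?A \<phi>) + ?e \<phi> * ?h t (ket a CL)" if "confined a b \<phi>" for t \<phi>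
  proof -
    have "?h (Suc t) \<phi> = ?h t (?B \<phi>)" by (simp only: funpow_Suc_right o_apply)
    also have "\<dots> = fps_nth (hit_fps a' b (?B \<phi>)) (Suc t)" by simp
    finally show ?thesis
      unfolding survive_decompose_at_barrier[OF that ab] hit_fps_add_scale by simp
  qed
  \<comment> \<open>Iterating \<open>step\<close> gives a renewal equation: the first arrival at
    \<open>a\<close> is at time s + 1. In the base case \<open>a'\<close> cannot be reached, since
    a' + 1 <= a.\<close>
  have conv: "?h t \<phi> = (\<Sum>s<t. ?e ((?A ^^ s) \<phi>) * ?h (t - Suc s) (ket a CL))" if "confined a b \<phi>" for t \<phi>
    using that
  proof (induction t arbitrary: \<phi>)
    case 0
    then show ?case using ab by (auto simp: evolution_apply intro!: coin_op_confined)
  next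
    case (Suc t)
    have "?h (Suc t) \<phi> = ?e \<phi> * ?h t (ket a CL) + ?h t (?A \<phi>)"
      using step[OF Suc.prems] by simp
    also have "?h t (?A \<phi>) = (\<Sum>s<t. ?e ((?A ^^ s) (?A \<phi>)) * ?h (t - Suc s) (ket a CL))"
      by (rule Suc.IH[OF confined_survive[OF Suc.prems]])
    finally show ?case
      by (simp only: sum.lessThan_Suc_shift funpow_Suc_right o_apply funpow_0 diff_Suc_1 diff_Suc_Suc minus_nat.diff_0)
  qed
  show ?thesis
  proof (rule fps_ext)
    fix n
    show "fps_nth (hit_fps a' b \<psi>) n = fps_nth (hit_fps a b \<psi> * hit_fps a' b (ket a CL)) n"
    proof (cases n)
      case (Suc t)
      have "fps_nth (hit_fps a b \<psi> * hit_fps a' b (ket a CL)) n =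
          (\<Sum>s\<le>t. ?e ((?A ^^ s) \<psi>) * fps_nth (hit_fps a' b (ket a CL)) (t - s))"
        unfolding Suc fps_mult_nth sum.atLeast0_atMost_Suc_shift by (simp add: atLeast0AtMost)
      \<comment> \<open>The term s = t drops out because \<open>hit_fps\<close> has no constant
        coefficient.\<close>
      also have "\<dots> = (\<Sum>s<t. ?e ((?A ^^ s) \<psi>) * fps_nth (hit_fps a' b (ket a CL)) (t - s))"
        by (simp add: lessThan_Suc_atMost[symmetric])
      also have "\<dots> = (\<Sum>s<t. ?e ((?A ^^ s) \<psi>) * fps_nth (hit_fps a' b (ket a CL)) (Suc (t - Suc s)))"
        by (intro sum.cong refl) (simp only: lessThan_iff Suc_diff_Suc)
      also have "\<dots> = ?h t \<psi>" using conv[OF \<psi>] by simp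
      finally show ?thesis using Suc by simp
    qed simp
  qed
qed

text \<open>After first passage at -1 the walk restarts from \<open>ket (-1) CL\<close>. Translating
  it back to 0 moves the right boundary to N + 1, so \<open>N\<close> varies in the
  induction.\<close>

lemma hit_fps_product:
  assumes "N \<ge> 1" "confined (-1) N \<psi>"
  shows "hit_fps (- int (Suc m)) N \<psi> =
           hit_fps (-1) N \<psi> * (\<Prod>k<m. hit_fps (-1) (N + int (Suc k)) (ket 0 CL))"
  using assms
proof (induction m arbitrary: N \<psi>)
  case (Suc m)
  have "ket 0 CL = translate (-1) (ket (-1) CL)"
    by (auto simp: translate_def ket_def fun_eq_iff)
  then have "hit_fps (- int (Suc (Suc m))) N (ket (-1) CL) = hit_fps (- int (Suc m)) (N + 1) (ket 0 CL)"
    by (simp add: hit_fps_translate)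
  also have "\<dots> = hit_fps (-1) (N + 1) (ket 0 CL) * (\<Prod>k<m. hit_fps (-1) (N + 1 + int (Suc k)) (ket 0 CL))"
    using Suc.prems by (intro Suc.IH confined_ket) auto
  also have "\<dots> = (\<Prod>k<Suc m. hit_fps (-1) (N + int (Suc k)) (ket 0 CL))"
    unfolding prod.lessThan_Suc_shift by (simp add: algebra_simps)
  finally show ?case
    using hit_fps_first_passage[OF Suc.prems(2), of "- int (Suc (Suc m))"] Suc.prems(1) by simp
qed simp

section \<open>Boundary values and the absorption integral\<close>

lemma fps_conv_radius_prod:
  fixes F :: "'i \<Rightarrow> complex fps"
  assumes "\<And>i. i \<in> I \<Longrightarrow> fps_conv_radius (F i) > r" "r < \<infinity>"
  shows "fps_conv_radius (\<Prod>i\<in>I. F i) > r"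
  using assms
proof (induction I rule: infinite_finite_induct)
  case (insert i I)
  then have "r < min (fps_conv_radius (F i)) (fps_conv_radius (\<Prod>i\<in>I. F i))" by simp
  also have "\<dots> \<le> fps_conv_radius (F i * (\<Prod>i\<in>I. F i))" by (rule fps_conv_radius_mult)
  finally show ?case using insert by simp
qed auto

lemma eval_fps_prod:
  fixes F :: "'i \<Rightarrow> complex fps"
  assumes "\<And>i. i \<in> I \<Longrightarrow> fps_conv_radius (F i) > norm z"
  shows "eval_fps (\<Prod>i\<in>I. F i) z = (\<Prod>i\<in>I. eval_fps (F i) z)"
  using assms
proof (induction I rule: infinite_finite_induct)
  case (insert i I)
  then have "fps_conv_radius (\<Prod>i\<in>I. F i) > norm z" by (intro fps_conv_radius_prod) auto
  with insert show ?case by (simp add: eval_fps_mult)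
qed auto

text \<open>The radius exceeds 1, so the sum of the series is continuous at \<open>z\<close>, and
  the limit from inside the disc is its value there.\<close>

lemma gen_fun_eq_eval_fps:
  assumes "n \<ge> 1" "cmod z = 1"
  shows "gen_fun c n z = eval_fps (hit_fps (-1) n (ket 0 c)) z"
proof -
  let ?F = "hit_fps (-1) n (ket 0 c)"
  have R: "fps_conv_radius ?F > 1" using assms by (intro hit_fps_conv_radius confined_ket) auto
  have "gen_series c n w = eval_fps ?F w" if "cmod w < 1" for w
  proof -
    have "ereal (cmod w) < fps_conv_radius ?F"
      using that R by (metis ereal_less(3) less_trans one_ereal_def)
    \<comment> \<open>Splitting off the zero constant term accounts for the exponent
      \<open>Suc t\<close> in \<open>gen_series\<close>.\<close>
    from suminf_split_head[OF summable_fps[OF this]] show ?thesis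
      by (simp add: gen_series_def eval_fps_def braket_ket)
  qed
  then have ev: "eventually (\<lambda>w. eval_fps ?F w = gen_series c n w) (at z within ball 0 1)"
    by (simp add: eventually_at_filter)
  have "continuous (at z within ball 0 1) (eval_fps ?F)"
    using R assms by (intro continuous_eval_fps) (simp add: one_ereal_def)
  then have "(eval_fps ?F \<longlongrightarrow> eval_fps ?F z) (at z within ball 0 1)"
    by (simp add: continuous_within)
  then have "(gen_series c n \<longlongrightarrow> eval_fps ?F z) (at z within ball 0 1)"
    by (rule Lim_transform_eventually[OF _ ev])
  moreover have "\<not> trivial_limit (at z within ball 0 1)"
    using assms by (simp add: trivial_limit_within islimpt_ball)
  ultimately show ?thesis unfolding gen_fun_def by (intro tendsto_Lim)
qed

lemma ell2_norm_Pi_yes_left: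
  assumes "confined a b \<psi>"
  shows "ell2_norm (Pi_yes a (evolution \<psi>)) = cmod (evolution \<psi> (a, CL))"
proof -
  have "c = CL" if "evolution \<psi> (a, c) \<noteq> 0" for c
    using that coin_op_confined[OF assms] by (cases c) (auto simp: evolution_apply)
  then have "(\<Sum>\<^sub>\<infinity>x. (cmod (Pi_yes a (evolution \<psi>) x))\<^sup>2) =
      (\<Sum>\<^sub>\<infinity>x\<in>{(a, CL)}. (cmod (Pi_yes a (evolution \<psi>) x))\<^sup>2)"
    by (intro infsum_cong_neutral) (auto simp: Pi_yes_def split: if_splits)
  then show ?thesis by (simp add: ell2_norm_def Pi_yes_def)
qed

text \<open>Parseval applied to the product series \<open>H\<close>, for all three starting coins at
  once.\<close>

lemma left_absorb_prob_integral:
  assumes M: "M \<ge> 1" and N: "N \<ge> 1" and init: "init_state \<alpha> \<beta> \<gamma> = ket 0 c"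
  shows "left_absorb_prob M N \<alpha> \<beta> \<gamma> = 1 / (2 * pi) * integral {0..2 * pi}
           (\<lambda>\<theta>. (cmod (gen_fun c N (cis \<theta>) * (\<Prod>k = 1..M - 1. gen_l (N + k) (cis \<theta>))))\<^sup>2)"
proof -
  define H where "H = hit_fps (-M) N (ket 0 c)"
  define m where "m = nat (M - 1)"
  have M_eq: "- M = - int (Suc m)" using M by (simp add: m_def)
  let ?F = "hit_fps (-1) N (ket 0 c)"
  let ?L = "\<lambda>k. hit_fps (-1) (N + int (Suc k)) (ket 0 CL)"
  have H: "H = ?F * (\<Prod>k<m. ?L k)"
    unfolding H_def M_eq using N by (intro hit_fps_product confined_ket) auto
  have conf: "confined (-M) N (ket 0 c)" using M N by (intro confined_ket) auto
  have F: "fps_conv_radius ?F > 1" and L: "\<And>k. fps_conv_radius (?L k) > 1"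
    using N by (auto intro!: hit_fps_conv_radius confined_ket)
  have eval: "eval_fps H (cis \<theta>) = gen_fun c N (cis \<theta>) * (\<Prod>k = 1..M - 1. gen_l (N + k) (cis \<theta>))" for \<theta>
  proof -
    have "eval_fps H (cis \<theta>) = eval_fps ?F (cis \<theta>) * (\<Prod>k<m. eval_fps (?L k) (cis \<theta>))"
      unfolding H using F L fps_conv_radius_prod[of "{..<m}" 1 ?L]
      by (simp add: eval_fps_mult eval_fps_prod flip: one_ereal_def)
    also have "\<dots> = gen_fun c N (cis \<theta>) * (\<Prod>k<m. gen_l (N + int (Suc k)) (cis \<theta>))"
      using N by (simp add: gen_fun_eq_eval_fps)
    also have "(\<Prod>k<m. gen_l (N + int (Suc k)) (cis \<theta>)) = (\<Prod>k = 1..M - 1. gen_l (N + k) (cis \<theta>))"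
      by (rule prod.reindex_bij_witness[of _ "\<lambda>k. nat (k - 1)" "\<lambda>k. int (Suc k)"]) (auto simp: m_def)
    finally show ?thesis .
  qed
  have HR: "fps_conv_radius H > 1" unfolding H_def by (rule hit_fps_conv_radius[OF conf])
  have "left_absorb_prob M N \<alpha> \<beta> \<gamma> = (\<Sum>t. (cmod (fps_nth H (Suc t)))\<^sup>2)"
    unfolding left_absorb_prob_def init H_def
    by (simp add: ell2_norm_Pi_yes_left[OF confined_survive_power[OF conf]])
  \<comment> \<open>Coefficient 0 of \<open>H\<close> is zero, so the sum may start there.\<close>
  also have "\<dots> = (\<Sum>t. (cmod (fps_nth H t))\<^sup>2)"
    using suminf_split_head[OF sums_summable[OF parseval_eval_fps[OF HR]]] by (simp add: H_def)
  also have "\<dots> = 1 / (2 * pi) * integral {0..2 * pi} (\<lambda>\<theta>. (cmod (eval_fps H (cis \<theta>)))\<^sup>2)"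
    by (rule sums_unique[OF parseval_eval_fps[OF HR], symmetric])
  finally show ?thesis by (simp only: eval)
qed

theorem mainTheorem8:
  fixes M N :: int
  assumes "M \<ge> 1" and "N \<ge> 1"
  shows "left_absorb_prob M N 1 0 0 =
           1 / (2 * pi) * integral {0..2 * pi}
             (\<lambda>\<theta>. (cmod (gen_l N (cis \<theta>) * (\<Prod>k = 1..M - 1. gen_l (N + k) (cis \<theta>))))\<^sup>2)
       \<and> left_absorb_prob M N 0 1 0 =
           1 / (2 * pi) * integral {0..2 * pi}
             (\<lambda>\<theta>. (cmod (gen_s N (cis \<theta>) * (\<Prod>k = 1..M - 1. gen_l (N + k) (cis \<theta>))))\<^sup>2)
       \<and> left_absorb_prob M N 0 0 1 =
           1 / (2 * pi) * integral {0..2 * pi}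
             (\<lambda>\<theta>. (cmod (gen_r N (cis \<theta>) * (\<Prod>k = 1..M - 1. gen_l (N + k) (cis \<theta>))))\<^sup>2)"
  using assms by (intro conjI left_absorb_prob_integral) (auto simp: init_state_def)

end
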